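(* The social welfare functional $\mathit{mec}$ (Maximising Expected Choiceworthiness) is Pascalian; that is, $\mathit{mec}$ is $k$-fanatical for every real $k \in (0, 0.5)$.
   Context: **Ethical frameworks.** Let $A$ be a set of actions. An ethical theory on $A$ is a function $t: A \to \mathbb{R}$. An ethical framework is a pair $F = (T, c)$ where $T$ is a finite set of ethical theories on $A$ and $c: T \to (0,1]$ is a credence function with $\sum_{t \in T} c(t) = 1$. **Social welfare functionals.** A social welfare functional $f$ assigns to every set of actions $A$ and every ethical framework $F$ on $A$ a total preorder $f(F, A)$ on $A$ (a complete, reflexive, transitive relation; ties are allowed). Two such orderings are equal iff they are equal as relations on $A$. **MEC.** For $F = (T,c)$ and $a \in A$ let $\mathit{wam}(F,a) = \sum_{t \in T} c(t)\, t(a)$. Then $\mathit{mec}(F,A) = \preceq_{\mathit{mec}}$ where, for $a, b \in A$, $a \preceq_{\mathit{mec}} b$ iff $\mathit{wam}(F,a) \le \mathit{wam}(F,b)$. **Restriction.** Given $F = (T,c)$ and a subset $T' \subset T$, the framework obtained by restricting $F$ to $T'$ is $(T', c')$ with $c'(t) = c(t) / \sum_{s \in T'} c(s)$ for $t \in T'$. **Extension.** Given $F = (T,c)$ and $T' \supset T$, a framework $F' = (T', c')$ is obtained by extending $F$ with $T'$ if for every $t \in T$, $c'(t) = n \cdot c(t)$, where $n = \frac{1 - \sum_{s \in T' \setminus T} c'(s)}{\sum_{s \in T} c(s)}$. (There are multiple ways of extending $F$ with $T'$, individuated by the credences $c'$ of the theories in $T' \setminus T$.) **Dominant subset.** Let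 $F = (T,c)$ be a framework, $A$ a set of actions and $f$ a social welfare functional. A subset $T_d \subset T$ is a dominant subset (given $F$, $A$, $f$) if $f(F,A) = f(F_d,A)$ and $f(F_d,A) \neq f(F_y,A)$, where $F_d$ is $F$ restricted to $T_d$ and $F_y$ is $F$ restricted to $T \setminus T_d$. **Fanaticism.** For $k \in (0,0.5)$, a social welfare functional $f$ is $k$-fanatical if for any set of actions $A$ and any ethical framework $F_y = (T_y, c_y)$ on $A$, there exists a framework $F = (T,c)$ obtained by extending $F_y$ with $T = T_d \cup T_y$, where $T_d \neq \emptyset$ is a set of theories disjoint from $T_y$ that is a dominant subset given $F$, $A$ and $f$, and $\sum_{t \in T_d} c(t) \le k$. A social welfare functional is Pascalian if it is $k$-fanatical for any $k \in (0,0.5)$.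
   Formalization: In the definition of k-fanatical, "any set of actions A" is restricted to sets with at least two actions; with at most one action all total preorders on A coincide, so no dominant subset can exist and the claim would be false. *)

theory Defs
  imports Complex_Main "HOL-Library.FuncSet"
begin

text \<open>
  Sets of actions are carrier sets \<open>A :: 'a set\<close>. Theories on \<open>A\<close> and credence functions on
  \<open>T\<close> are extensional functions, so that equality of theories (and hence membership in and
  disjointness of sets of theories) is equality of functions on \<open>A\<close>, and equality of frameworks
  is equality of pairs.
\<close>

type_synonym 'a ethical_theory = "'a \<Rightarrow> real"

type_synonym 'a framework = "'a ethical_theory set \<times> ('a ethical_theory \<Rightarrow> real)"

definition ethical_theories :: "'a set \<Rightarrow> 'a ethical_theory set" where
  "ethical_theories A = A \<rightarrow>\<^sub>E UNIV"

definition ethical_framework :: "'a set \<Rightarrow> 'a framework \<Rightarrow> bool" where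
  "ethical_framework A F \<longleftrightarrow>
     (case F of (T, c) \<Rightarrow>
        finite T \<and> T \<subseteq> ethical_theories A \<and> c \<in> T \<rightarrow>\<^sub>E {0<..1} \<and> (\<Sum>t\<in>T. c t) = 1)"

type_synonym 'a swf = "'a framework \<Rightarrow> 'a set \<Rightarrow> 'a rel"

text \<open>A pair \<open>(a, b)\<close> in an ordering means that \<open>a\<close> is ranked weakly below \<open>b\<close>.\<close>

definition social_welfare_functional :: "'a swf \<Rightarrow> bool" where
  "social_welfare_functional f \<longleftrightarrow>
     (\<forall>A F. ethical_framework A F \<longrightarrow> preorder_on A (f F A) \<and> total_on A (f F A))"

definition wam :: "'a framework \<Rightarrow> 'a \<Rightarrow> real" where
  "wam F a = (case F of (T, c) \<Rightarrow> \<Sum>t\<in>T. c t * t a)"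

definition mec :: "'a swf" where
  "mec F A = {(a, b). a \<in> A \<and> b \<in> A \<and> wam F a \<le> wam F b}"

definition restrict_framework :: "'a framework \<Rightarrow> 'a ethical_theory set \<Rightarrow> 'a framework" where
  "restrict_framework F T' = (case F of (T, c) \<Rightarrow> (T', \<lambda>t\<in>T'. c t / (\<Sum>s\<in>T'. c s)))"

definition obtained_by_extending ::
    "'a set \<Rightarrow> 'a framework \<Rightarrow> 'a ethical_theory set \<Rightarrow> 'a framework \<Rightarrow> bool" where
  "obtained_by_extending A F T' F' \<longleftrightarrow>
     (case (F, F') of ((T, c), (S, c')) \<Rightarrow>
        S = T' \<and> T \<subset> T' \<and> ethical_framework A F' \<and>
        (let n = (1 - (\<Sum>s\<in>T' - T. c' s)) / (\<Sum>s\<in>T. c s) in \<forall>t\<in>T. c' t = n * c t))"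

text \<open>The inclusion is proper because a framework has at least one theory, so \<open>T - Td\<close> must be
  nonempty for the restriction to it to be a framework.\<close>

definition dominant_subset ::
    "'a framework \<Rightarrow> 'a set \<Rightarrow> 'a swf \<Rightarrow> 'a ethical_theory set \<Rightarrow> bool" where
  "dominant_subset F A f Td \<longleftrightarrow>
     (case F of (T, c) \<Rightarrow>
        Td \<subset> T \<and>
        f F A = f (restrict_framework F Td) A \<and>
        f (restrict_framework F Td) A \<noteq> f (restrict_framework F (T - Td)) A)"

text \<open>Only sets with at least two actions are considered: a set with at most one action carries
  exactly one total preorder, so no dominant subset exists there and no social welfare functional
  would be fanatical for any \<open>k\<close>.\<close>

definition fanatical :: "real \<Rightarrow> 'a swf \<Rightarrow> bool" where
  "fanatical k f \<longleftrightarrow>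
     (\<forall>A Ty cy. (\<exists>a\<in>A. \<exists>b\<in>A. a \<noteq> b) \<and> ethical_framework A (Ty, cy) \<longrightarrow>
        (\<exists>Td c. Td \<noteq> {} \<and> Td \<inter> Ty = {} \<and>
           obtained_by_extending A (Ty, cy) (Td \<union> Ty) (Td \<union> Ty, c) \<and>
           dominant_subset (Td \<union> Ty, c) A f Td \<and>
           (\<Sum>t\<in>Td. c t) \<le> k))"

definition pascalian :: "'a swf \<Rightarrow> bool" where
  "pascalian f \<longleftrightarrow> (\<forall>k. 0 < k \<and> k < 1/2 \<longrightarrow> fanatical k f)"

end

theory Submission
  imports Defs
begin

text \<open>
  Let \<open>w\<close> be the expected choiceworthiness of the given framework. Adding one theory \<open>t\<close> with
  credence \<open>k\<close> turns it into \<open>k t + (1 - k) w\<close>. If \<open>w\<close> is not constant, take \<open>t = - M w\<close> with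
  \<open>k M > 1 - k\<close>, so that the sum is a negative multiple of \<open>w\<close> and is ordered like \<open>t\<close>, opposite
  to \<open>w\<close>. If \<open>w\<close> is constant, any nonconstant \<open>t\<close> will do. The freedom in the scaling factor \<open>M\<close>
  allows \<open>t\<close> to avoid the finitely many theories already present. This works for infinite sets of
  actions too.
\<close>

lemma social_welfare_functional_mec: "social_welfare_functional mec"
  unfolding social_welfare_functional_def mec_def preorder_on_def
  by (auto simp: refl_on_def total_on_def intro!: transI)

lemma mec_eqI:
  assumes "\<And>a b. a \<in> A \<Longrightarrow> b \<in> A \<Longrightarrow> wam F a \<le> wam F b \<longleftrightarrow> wam G a \<le> wam G b"
  shows "mec F A = mec G A"
  using assms by (auto simp: mec_def)

lemma wam_restrict_singleton:
  assumes "c t \<noteq> 0"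
  shows "wam (restrict_framework (T, c) {t}) a = t a"
  using assms by (simp add: wam_def restrict_framework_def)

definition add_theory :: "real \<Rightarrow> 'a ethical_theory \<Rightarrow> 'a ethical_theory set \<Rightarrow>
    ('a ethical_theory \<Rightarrow> real) \<Rightarrow> ('a ethical_theory \<Rightarrow> real)" where
  "add_theory k t T c = (\<lambda>s\<in>insert t T. if s = t then k else (1 - k) * c s)"

text \<open>The weight \<open>g\<close> is left free to serve two purposes: \<open>g = 1\<close>
  gives the total credence, and evaluation at an action gives \<open>wam\<close>.\<close>

lemma sum_add_theory:
  assumes "finite T" "t \<notin> T"
  shows "(\<Sum>s\<in>insert t T. add_theory k t T c s * g s) = k * g t + (1 - k) * (\<Sum>s\<in>T. c s * g s)"
proof -
  have "(\<Sum>s\<in>T. add_theory k t T c s * g s) = (\<Sum>s\<in>T. (1 - k) * (c s * g s))"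
    using assms by (intro sum.cong) (auto simp: add_theory_def)
  then show ?thesis
    using assms by (simp add: sum_distrib_left add_theory_def)
qed

lemma ethical_framework_add_theory:
  assumes F: "ethical_framework A (T, c)" and t: "t \<in> ethical_theories A" "t \<notin> T"
    and k: "0 < k" "k < 1"
  shows "ethical_framework A (insert t T, add_theory k t T c)"
proof -
  have c: "finite T" "(\<Sum>s\<in>T. c s) = 1" "\<And>s. s \<in> T \<Longrightarrow> 0 < c s \<and> c s \<le> 1"
    using F by (auto simp: ethical_framework_def)
  have "(\<Sum>s\<in>insert t T. add_theory k t T c s) = 1"
    using sum_add_theory[of T t k c "\<lambda>_. 1"] c t by simp
  moreover have "add_theory k t T c \<in> insert t T \<rightarrow>\<^sub>E {0<..1}"
    using c(3) k by (auto simp: add_theory_def less_imp_le intro!: mult_le_one)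
  ultimately show ?thesis
    using F t by (auto simp: ethical_framework_def)
qed

lemma obtained_by_extending_add_theory:
  assumes F: "ethical_framework A (T, c)" and t: "t \<in> ethical_theories A" "t \<notin> T"
    and k: "0 < k" "k < 1"
  shows "obtained_by_extending A (T, c) (insert t T) (insert t T, add_theory k t T c)"
proof -
  have "insert t T - T = {t}" "(\<Sum>s\<in>T. c s) = 1"
    using F t by (auto simp: ethical_framework_def)
  then show ?thesis
    using ethical_framework_add_theory[OF assms] t
    by (auto simp: obtained_by_extending_def Let_def add_theory_def)
qed

text \<open>Normalising cancels the common factor \<open>1 - k\<close>. Outside \<open>T\<close>
  both credence functions take the default value, so the frameworks are equal as pairs.\<close>

lemma restrict_add_theory:
  assumes F: "ethical_framework A (T, c)" and t: "t \<notin> T" and k: "k < 1"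
  shows "restrict_framework (insert t T, add_theory k t T c) T = (T, c)"
proof -
  have "(\<Sum>s\<in>T. add_theory k t T c s) = (\<Sum>s\<in>T. (1 - k) * c s)"
    using t by (intro sum.cong) (auto simp: add_theory_def)
  also have "\<dots> = 1 - k"
    using F by (simp add: sum_distrib_left[symmetric] ethical_framework_def)
  finally have "(\<Sum>s\<in>T. add_theory k t T c s) = 1 - k" .
  moreover have "c \<in> extensional T"
    using F by (auto simp: ethical_framework_def PiE_def)
  ultimately show ?thesis
    using t k
    by (auto simp: restrict_framework_def add_theory_def intro!: extensionalityI[of _ T])
qed

text \<open>Evaluation at \<open>a\<close>, where \<open>g\<close> does not vanish, recovers
  \<open>M\<close> from the scaled theory. Hence the unbounded ray of factors yields infinitely many
  theories, which \<open>T\<close> cannot all contain.\<close>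

lemma scaled_theory_avoiding_finite:
  assumes "finite T" and "a \<in> A" and "g a \<noteq> (0::real)"
  obtains M where "M > M0" and "(\<lambda>x\<in>A. M * g x) \<notin> T"
proof -
  have "inj_on (\<lambda>M. \<lambda>x\<in>A. M * g x) {M0<..}"
    using assms(2,3) by (auto intro!: inj_onI dest!: fun_cong[of _ _ a])
  then have "infinite ((\<lambda>M. \<lambda>x\<in>A. M * g x) ` {M0<..})"
    using infinite_Ioi by (auto dest: finite_imageD)
  then have "\<not> (\<lambda>M. \<lambda>x\<in>A. M * g x) ` {M0<..} \<subseteq> T"
    using assms(1) finite_subset by blast
  then show ?thesis using that by auto
qed

text \<open>Treats constant and nonconstant \<open>w\<close> uniformly: \<open>g\<close> is the
  direction of the new theory, and the pair \<open>x\<close>, \<open>y\<close> witnesses that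
  \<open>g\<close> and \<open>w\<close> order \<open>A\<close> differently.\<close>

lemma overruling_direction:
  fixes w :: "'a \<Rightarrow> real"
  assumes "a \<in> A" "b \<in> A" "a \<noteq> b" and k: "0 < k"
  obtains x y and g :: "'a \<Rightarrow> real" and M0 where
    "x \<in> A" "y \<in> A" "g x < g y" "w y \<le> w x" "M0 \<ge> 0"
    "\<And>M u v. M > M0 \<Longrightarrow> u \<in> A \<Longrightarrow> v \<in> A \<Longrightarrow>
       k * (M * g u) + (1 - k) * w u \<le> k * (M * g v) + (1 - k) * w v \<longleftrightarrow> g u \<le> g v"
proof (cases "\<exists>x\<in>A. \<exists>y\<in>A. w y < w x")
  case True
  then obtain x y where xy: "x \<in> A" "y \<in> A" "w y < w x" by blast
  show ?thesis
  \<comment> \<open>Beyond \<open>(1 - k) / k\<close> the mixture is \<open>w\<close> times the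
    negative number \<open>(1 - k) - k * M\<close>. The maximum with 0 secures
    \<open>M0 \<ge> 0\<close> even if \<open>k > 1\<close>.\<close>
  proof (rule that[of x y "\<lambda>u. - w u" "max 0 ((1 - k) / k)"])
    fix M u v
    assume "M > max 0 ((1 - k) / k)"
    then have "k * M - (1 - k) > 0"
      using k by (simp add: field_simps)
    then have "(k * M - (1 - k)) * w v \<le> (k * M - (1 - k)) * w u \<longleftrightarrow> w v \<le> w u"
      by simp
    then show "k * (M * - w u) + (1 - k) * w u \<le> k * (M * - w v) + (1 - k) * w v
        \<longleftrightarrow> - w u \<le> - w v"
      by (simp add: algebra_simps)
  qed (use xy in auto)
next
  case False
  then have w: "w u = w v" if "u \<in> A" "v \<in> A" for u v
    using that by (meson linorder_less_linear)
  show ?thesis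
  \<comment> \<open>The \<open>w\<close> terms cancel, so the indicator of \<open>a\<close> decides
    the order under any positive scaling; it puts \<open>b\<close> strictly below \<open>a\<close>,
    which \<open>w\<close> ties.\<close>
  proof (rule that[of b a "\<lambda>u. if u = a then 1 else 0" 0])
    fix M :: real and u v
    assume "M > 0" "u \<in> A" "v \<in> A"
    then show "k * (M * (if u = a then 1 else 0)) + (1 - k) * w u
        \<le> k * (M * (if v = a then 1 else 0)) + (1 - k) * w v
        \<longleftrightarrow> (if u = a then 1 else (0::real)) \<le> (if v = a then 1 else 0)"
      using k w[of u v] mult_pos_pos[of k M] by (auto simp: not_le)
  qed (use assms w[of a b] in auto)
qed

lemma fanatical_mec:
  assumes k: "0 < k" "k < 1"
  shows "fanatical k (mec :: 'a swf)"
  unfolding fanatical_def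
proof (intro allI impI, elim conjE bexE)
  fix A :: "'a set" and T c a b
  assume ab: "a \<in> A" "b \<in> A" "a \<noteq> b" and F: "ethical_framework A (T, c)"
  let ?w = "wam (T, c)"
  \<comment> \<open>An empty sum of credences would be 0, not 1. Nonemptiness makes
    \<open>{t}\<close> a proper subset of \<open>insert t T\<close>.\<close>
  have fin: "finite T" and ne: "T \<noteq> {}"
    using F by (auto simp: ethical_framework_def)
  obtain x y g M0 where xy: "x \<in> A" "y \<in> A" "g x < g y" "?w y \<le> ?w x" and M0: "M0 \<ge> 0"
    and g: "\<And>M u v. M > M0 \<Longrightarrow> u \<in> A \<Longrightarrow> v \<in> A \<Longrightarrow>
      k * (M * g u) + (1 - k) * ?w u \<le> k * (M * g v) + (1 - k) * ?w v \<longleftrightarrow> g u \<le> g v"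
    using overruling_direction[OF ab k(1), of ?w] by blast
  \<comment> \<open>Since \<open>g x < g y\<close>, at least one of the two values is
    nonzero.\<close>
  obtain z where "z \<in> A" "g z \<noteq> 0"
    using xy by (cases "g x = 0") auto
  then obtain M where M: "M > M0" and nin: "(\<lambda>u\<in>A. M * g u) \<notin> T"
    by (rule scaled_theory_avoiding_finite[OF fin])
  define t where "t = (\<lambda>u\<in>A. M * g u)"
  define c' where "c' = add_theory k t T c"
  have t: "t \<in> ethical_theories A" "t \<notin> T"
    using nin by (auto simp: t_def ethical_theories_def)
  have tA: "t u = M * g u" if "u \<in> A" for u
    using that by (simp add: t_def)
  have c't: "c' t = k"
    by (simp add: c'_def add_theory_def)
  have wam_new: "wam (insert t T, c') u = k * t u + (1 - k) * ?w u" for u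
    using sum_add_theory[OF fin t(2), of k c "\<lambda>s. s u"] by (simp add: wam_def c'_def)
  have wam_d: "wam (restrict_framework (insert t T, c') {t}) u = t u" for u
    using c't k by (simp add: wam_restrict_singleton)
  have restr: "restrict_framework (insert t T, c') (insert t T - {t}) = (T, c)"
    using restrict_add_theory[OF F t(2) k(2)] t(2) by (simp add: c'_def)
  \<comment> \<open>Both comparisons reduce to \<open>g u \<le> g v\<close>: the left by the choice
    of \<open>M0\<close>, the right because \<open>M > 0\<close> cancels.\<close>
  have "mec (insert t T, c') A = mec (restrict_framework (insert t T, c') {t}) A"
    using g[OF M] M M0 by (intro mec_eqI) (simp add: wam_new wam_d tA)
  moreover have "mec (restrict_framework (insert t T, c') {t}) A \<noteq> mec (T, c) A"
  proof -
    \<comment> \<open>The old theories rank \<open>y\<close> weakly below \<open>x\<close>, while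
      \<open>t\<close> ranks \<open>y\<close> strictly above \<open>x\<close>.\<close>
    have "(y, x) \<in> mec (T, c) A"
      using xy by (simp add: mec_def)
    moreover have "(y, x) \<notin> mec (restrict_framework (insert t T, c') {t}) A"
      using xy M M0 by (simp add: mec_def wam_d tA)
    ultimately show ?thesis by auto
  qed
  ultimately have "dominant_subset (insert t T, c') A mec {t}"
    using ne t(2) restr by (auto simp: dominant_subset_def)
  then show "\<exists>Td c'. Td \<noteq> {} \<and> Td \<inter> T = {} \<and>
      obtained_by_extending A (T, c) (Td \<union> T) (Td \<union> T, c') \<and>
      dominant_subset (Td \<union> T, c') A mec Td \<and> (\<Sum>t\<in>Td. c' t) \<le> k"
    using obtained_by_extending_add_theory[OF F t k] t(2) c't
    by (intro exI[of _ "{t}"] exI[of _ c']) (simp add: c'_def)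
qed

theorem theorem12:
  shows "social_welfare_functional (mec :: 'a swf) \<and> pascalian (mec :: 'a swf)"
  by (simp add: social_welfare_functional_mec pascalian_def fanatical_mec)

end
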